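(* Let $d\ge2$. For every $\Lambda\in\mathcal{WR}_d$, $\operatorname{CovRad}_{\mathcal O^d}(\Lambda)=q^{-1}$.
   Context: Let $q$ be a prime power, $\mathcal R=\mathbb F_q[x]$, and $\tilde{\mathcal K}=\mathbb F_q((x^{-1}))$, with the absolute value $|\cdot|$ extending $|f|=q^{\deg f}$ for nonzero $f\in\mathcal R$ (and $|0|=0$); $\mathcal O=\mathbb F_q[[x^{-1}]]=\{f\in\tilde{\mathcal K}:|f|\le1\}$. On $\tilde{\mathcal K}^d$ use the norm $\|\mathbf v\|=\max_i|v_i|$. $\mathcal L_d$ is the space of unimodular lattices in $\tilde{\mathcal K}^d$, i.e. sets $g\mathcal R^d$ with $g$ an invertible $d\times d$ matrix over $\tilde{\mathcal K}$ with $|\det(g)|=1$. Let $\ell(\Lambda)=\min\{\|\mathbf v\|:\mathbf v\in\Lambda\setminus\{0\}\}$. A lattice $\Lambda\in\mathcal L_d$ is well rounded if it contains $d$ linearly independent vectors of norm $\ell(\Lambda)$; $\mathcal{WR}_d$ is the set of well rounded lattices in $\mathcal L_d$. For real $r>0$, $r\mathcal O^d=\{\mathbf v\in\tilde{\mathcal K}^d:\|\mathbf v\|\le r\}$, and $\operatorname{CovRad}_{\mathcal O^d}(\Lambda)$ is the smallest $r>0$ such that $\Lambda+r\mathcal O^d=\tilde{\mathcal K}^d$. *)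

theory Defs
  imports
    "HOL-Analysis.Analysis"
    "HOL-Computational_Algebra.Computational_Algebra"
begin

text \<open>
  The ground field is a type \<open>'a :: {field, finite}\<close>, so \<open>q = CARD('a)\<close>. A field of
  Laurent series in \<open>x\<^sup>-\<^sup>1\<close> over it is \<open>'a fls\<close>, whose formal variable \<^const>\<open>fls_X\<close>
  stands for \<open>x\<^sup>-\<^sup>1\<close>; the indeterminate \<open>x\<close> is therefore \<^const>\<open>fls_X_inv\<close>.
  The dimension is \<open>d = CARD('d)\<close>.
\<close>

definition fls_of_poly :: "'a::field poly \<Rightarrow> 'a fls" where
  "fls_of_poly p = poly (map_poly fls_const p) fls_X_inv"

definition poly_ring :: "'a::field fls set" where
  "poly_ring = range fls_of_poly"

text \<open>
  The exponent is the largest power of \<open>x\<close> occurring in \<open>f\<close>, i.e. minus the least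
  power of \<open>x\<^sup>-\<^sup>1\<close>.
\<close>

definition fls_abs :: "'a::{field,finite} fls \<Rightarrow> real" where
  "fls_abs f = (if f = 0 then 0 else real CARD('a) powi (- fls_subdegree f))"

lemma fls_nth_fls_of_poly:
  "fls_nth (fls_of_poly p) n = (if n \<le> 0 then coeff p (nat (- n)) else 0)"
proof (induction p arbitrary: n)
  case 0
  then show ?case by (simp add: fls_of_poly_def)
next
  case (pCons a p)
  have "fls_of_poly (pCons a p) = fls_const a + fls_X_inv * fls_of_poly p"
    using pCons.hyps by (simp add: fls_of_poly_def map_poly_pCons)
  then have "fls_nth (fls_of_poly (pCons a p)) n = fls_nth (fls_const a) n + fls_nth (fls_of_poly p) (n + 1)"
    by (simp add: fls_X_inv_times_conv_shift)
  moreover have "nat (- n) = Suc (nat (- (n + 1)))" if "n < 0"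
    using that by simp
  ultimately show ?case
    by (cases "n < 0") (auto simp: pCons.IH coeff_pCons split: nat.split)
qed

lemma fls_abs_fls_of_poly:
  fixes p :: "'a::{field,finite} poly"
  assumes "p \<noteq> 0"
  shows "fls_abs (fls_of_poly p) = real CARD('a) ^ degree p"
proof -
  have nz: "fls_nth (fls_of_poly p) (- int (degree p)) \<noteq> 0"
    using assms by (simp add: fls_nth_fls_of_poly)
  have "fls_subdegree (fls_of_poly p) = - int (degree p)"
    by (rule fls_subdegree_eqI[OF nz]) (auto simp: fls_nth_fls_of_poly intro: coeff_eq_0)
  with nz show ?thesis
    by (auto simp: fls_abs_def)
qed

definition vec_norm :: "'a::{field,finite} fls ^ 'd \<Rightarrow> real" where
  "vec_norm v = Max (range (\<lambda>i. fls_abs (v $ i)))"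

definition poly_vectors :: "('a::field fls ^ 'd) set" where
  "poly_vectors = {v. \<forall>i. v $ i \<in> poly_ring}"

definition unimodular_lattices :: "('a::{field,finite} fls ^ 'd) set set" where
  "unimodular_lattices =
    {(\<lambda>v. g *v v) ` poly_vectors | g :: 'a fls ^ 'd ^ 'd. invertible g \<and> fls_abs (det g) = 1}"

text \<open>
  Below, \<open>LEAST\<close> over the reals denotes an attained minimum; where there is none it is
  an unspecified real number.
\<close>

definition shortest_length :: "('a::{field,finite} fls ^ 'd) set \<Rightarrow> real" where
  "shortest_length L = (LEAST r. r \<in> vec_norm ` (L - {0}))"

definition well_rounded :: "('a::{field,finite} fls ^ 'd) set \<Rightarrow> bool" where
  "well_rounded L \<longleftrightarrow>
    (\<exists>B \<subseteq> L. card B = CARD('d) \<and> vec.independent B \<and> (\<forall>v\<in>B. vec_norm v = shortest_length L))"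

definition well_rounded_lattices :: "('a::{field,finite} fls ^ 'd) set set" where
  "well_rounded_lattices = {L \<in> unimodular_lattices. well_rounded L}"

definition norm_cball :: "real \<Rightarrow> ('a::{field,finite} fls ^ 'd) set" where
  "norm_cball r = {v. vec_norm v \<le> r}"

definition cov_rad :: "('a::{field,finite} fls ^ 'd) set \<Rightarrow> real" where
  "cov_rad L = (LEAST r. r > 0 \<and> {u + w | u w. u \<in> L \<and> w \<in> norm_cball r} = UNIV)"

end

theory Submission
  imports Defs
begin

text \<open>
  A well rounded unimodular lattice \<open>\<Lambda>\<close> is the image of the standard lattice \<open>\<R>\<^sup>d\<close> of vectors
  with polynomial entries under a linear isometry of the ultrametric norm, so its covering
  radius is that of \<open>\<R>\<^sup>d\<close>.

  The isometry comes from \<open>d\<close> linearly independent shortest vectors. Over \<open>\<real>\<close>, independent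
  shortest vectors need neither be orthogonal nor generate the lattice, but here they do both,
  because the norm is ultrametric and the constants lie in \<open>\<R>\<close>. Their leading coefficient
  vectors are independent over the ground field: a cancelling constant combination would be a
  shorter nonzero lattice vector. By comparing leading coefficients, the matrix \<open>M\<close>
  with these vectors as columns multiplies the norm by the length \<open>\<ell>\<close> of the shortest vectors
  (\<open>similarity_of_constant_combinations\<close>). Writing a lattice vector as \<open>M a\<close> and removing the
  polynomial part of \<open>a\<close> leaves a lattice vector of norm at most \<open>\<ell> / q\<close>, which must vanish; so
  \<open>\<Lambda> = M \<R>\<^sup>d\<close> (\<open>well_rounded_orthogonal_basis\<close>).

  Two bases of one lattice have determinants of the same absolute value
  (\<open>sublattice_covolume_ge\<close>), whence \<open>\<bar>det M\<bar> = 1\<close>. A similarity of ratio \<open>\<ell>\<close> has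
  \<open>\<bar>det M\<bar> = \<ell>\<^sup>d\<close>, so \<open>\<ell> = 1\<close> (\<open>similarity_ratio_1\<close>) and \<open>M\<close> is an isometry.

  Finally, the covering radius of \<open>\<R>\<^sup>d\<close> is \<open>q\<^sup>-\<^sup>1\<close>: fractional parts have absolute value at
  most \<open>q\<^sup>-\<^sup>1\<close>, and \<open>x\<^sup>-\<^sup>1\<close> is at distance at least \<open>q\<^sup>-\<^sup>1\<close> from every polynomial.
\<close>

(* Frees the infix for vector components. *)
no_notation fps_nth (infixl "$" 75)

section \<open>The absolute value\<close>

lemma card_field_gt_1: "real CARD('a::{field,finite}) > 1"
proof -
  have "card {0, 1 :: 'a} \<le> CARD('a)" by (rule card_mono) auto
  then show ?thesis by simp
qed

lemma card_powi_le_iff [simp]: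
  "real CARD('a::{field,finite}) powi m \<le> real CARD('a) powi n \<longleftrightarrow> m \<le> n"
  using power_int_strict_increasing[of n m "real CARD('a)"] power_int_increasing[of m n "real CARD('a)"]
    card_field_gt_1[where 'a = 'a] by (force simp: not_le[symmetric])

lemma card_powi_less_iff [simp]:
  "real CARD('a::{field,finite}) powi m < real CARD('a) powi n \<longleftrightarrow> m < n"
  by (simp add: not_le[symmetric])

lemma card_powi_eq_iff [simp]:
  "real CARD('a::{field,finite}) powi m = real CARD('a) powi n \<longleftrightarrow> m = n"
  by (simp add: order_eq_iff)

lemma fls_abs_nonneg: "fls_abs f \<ge> 0"
  by (simp add: fls_abs_def)

lemma fls_abs_le_powi_iff:
  fixes f :: "'a::{field,finite} fls"
  shows "fls_abs f \<le> real CARD('a) powi n \<longleftrightarrow> (\<forall>k < - n. fls_nth f k = 0)"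
proof (cases "f = 0")
  case False
  have "fls_abs f \<le> real CARD('a) powi n \<longleftrightarrow> - fls_subdegree f \<le> n"
    using False by (simp add: fls_abs_def)
  also have "\<dots> \<longleftrightarrow> (\<forall>k < - n. fls_nth f k = 0)"
  proof
    assume "- fls_subdegree f \<le> n"
    then show "\<forall>k < - n. fls_nth f k = 0" by auto
  next
    assume "\<forall>k < - n. fls_nth f k = 0"
    then show "- fls_subdegree f \<le> n"
      using nth_fls_subdegree_nonzero[OF False] by force
  qed
  finally show ?thesis .
qed (simp add: fls_abs_def)

lemma fls_abs_mult: "fls_abs (f * g) = fls_abs f * fls_abs g"
  using card_field_gt_1[where 'a = 'a]
  by (auto simp: fls_abs_def power_int_add power_int_diff power_int_minus field_simps)

lemma fls_abs_one [simp]: "fls_abs 1 = 1"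
  by (simp add: fls_abs_def)

lemma fls_abs_uminus [simp]: "fls_abs (- f) = fls_abs f"
  by (simp add: fls_abs_def)

lemma fls_abs_pos: "f \<noteq> 0 \<Longrightarrow> fls_abs f > 0"
  using card_field_gt_1[where 'a = 'a] by (simp add: fls_abs_def)

lemma fls_abs_cases:
  fixes f :: "'a::{field,finite} fls"
  obtains "f = 0" | n where "fls_abs f = real CARD('a) powi n"
  by (cases "f = 0") (auto simp: fls_abs_def)

lemma fls_abs_add_le:
  fixes f g :: "'a::{field,finite} fls"
  assumes "fls_abs f \<le> r" "fls_abs g \<le> r"
  shows "fls_abs (f + g) \<le> r"
proof -
  have *: "fls_abs (f + g) \<le> fls_abs g" if "fls_abs f \<le> fls_abs g" for f g :: "'a fls"
  proof (cases g rule: fls_abs_cases)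
    case 1
    then show ?thesis using that fls_abs_pos[of f] by (cases "f = 0") (auto simp: fls_abs_def)
  next
    case (2 n)
    then have "\<forall>k < - n. fls_nth g k = 0" "\<forall>k < - n. fls_nth f k = 0"
      using that by (simp_all flip: fls_abs_le_powi_iff)
    then show ?thesis unfolding 2 fls_abs_le_powi_iff by simp
  qed
  show ?thesis
    using *[of f g] *[of g f] assms by (cases "fls_abs f \<le> fls_abs g") (auto simp: add.commute)
qed

lemma fls_abs_sum_le:
  assumes "\<And>i. i \<in> A \<Longrightarrow> fls_abs (f i) \<le> r" "r \<ge> 0"
  shows "fls_abs (sum f A) \<le> r"
  using assms(1)
  by (induction A rule: infinite_finite_induct)
    (auto simp: assms(2) fls_abs_def[of 0] intro: fls_abs_add_le)

text \<open>The exponents \<open>a\<close> and \<open>b\<close> only bound the subdegrees from below, so that the coefficients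
  on the right may vanish; this lets all entries of a matrix share one exponent.\<close>

lemma fls_times_nth_lowest:
  fixes f g :: "'a::field fls"
  assumes "\<forall>k<a. fls_nth f k = 0" "\<forall>k<b. fls_nth g k = 0"
  shows "fls_nth (f * g) (a + b) = fls_nth f a * fls_nth g b"
proof (cases "f = 0 \<or> g = 0")
  case False
  then have nz: "fls_nth f (fls_subdegree f) \<noteq> 0" "fls_nth g (fls_subdegree g) \<noteq> 0"
    by auto
  then have ge: "fls_subdegree f \<ge> a" "fls_subdegree g \<ge> b"
    using assms by (meson not_le_imp_less)+
  show ?thesis
  proof (cases "fls_subdegree f = a \<and> fls_subdegree g = b")
    case True
    then show ?thesis using fls_times_base[of f g] by auto
  next
    case False
    then have "fls_subdegree f > a \<or> fls_subdegree g > b" using ge by auto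
    then have "fls_nth f a * fls_nth g b = 0" by auto
    moreover have "fls_nth (f * g) (a + b) = 0"
      using ge False \<open>\<not> (f = 0 \<or> g = 0)\<close> by (intro fls_eq0_below_subdegree) auto
    ultimately show ?thesis by simp
  qed
qed auto

section \<open>The norm\<close>

lemma vec_norm_le_iff: "vec_norm v \<le> r \<longleftrightarrow> (\<forall>i. fls_abs (v $ i) \<le> r)"
  by (auto simp: vec_norm_def)

lemma fls_abs_le_vec_norm: "fls_abs (v $ i) \<le> vec_norm v"
  using vec_norm_le_iff[of v "vec_norm v"] by simp

lemma vec_norm_nonneg: "vec_norm v \<ge> 0"
  using fls_abs_le_vec_norm[of v undefined] fls_abs_nonneg order_trans by blast

lemma vec_norm_0 [simp]: "vec_norm 0 = 0"
  by (simp add: antisym vec_norm_le_iff vec_norm_nonneg fls_abs_def)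

lemma vec_norm_smult: "vec_norm (c *s v) = fls_abs c * vec_norm v"
proof (cases "c = 0")
  case False
  have le: "vec_norm (c *s v) \<le> fls_abs c * vec_norm v" for c v
    by (auto simp: vec_norm_le_iff fls_abs_mult intro!: mult_left_mono fls_abs_le_vec_norm fls_abs_nonneg)
  have "fls_abs c * vec_norm v = fls_abs c * vec_norm (inverse c *s (c *s v))"
    using False by simp
  also have "\<dots> \<le> fls_abs c * (fls_abs (inverse c) * vec_norm (c *s v))"
    by (intro mult_left_mono le fls_abs_nonneg)
  also have "\<dots> = fls_abs (c * inverse c) * vec_norm (c *s v)"
    by (simp add: fls_abs_mult)
  finally show ?thesis using False le[of c v] by simp
qed (simp add: fls_abs_def)

lemma vec_norm_powi:
  fixes v :: "'a::{field,finite} fls ^ 'd"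
  assumes "v \<noteq> 0"
  obtains n where "vec_norm v = real CARD('a) powi n"
proof -
  have "vec_norm v \<in> range (\<lambda>i. fls_abs (v $ i))"
    unfolding vec_norm_def by (rule Max_in) auto
  then obtain i where i: "vec_norm v = fls_abs (v $ i)" by auto
  obtain j where "v $ j \<noteq> 0" using assms by (auto simp: vec_eq_iff)
  then have "fls_abs (v $ i) > 0"
    using fls_abs_pos[of "v $ j"] fls_abs_le_vec_norm[of v j] i by linarith
  then show ?thesis
    using that i by (cases "v $ i" rule: fls_abs_cases) (auto simp: fls_abs_def)
qed

text \<open>The value group is discrete: the norm has no values strictly between \<open>q\<^sup>n\<^sup>-\<^sup>1\<close> and \<open>q\<^sup>n\<close>.\<close>

lemma vec_norm_less_imp_le_powi:
  fixes v :: "'a::{field,finite} fls ^ 'd"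
  assumes "vec_norm v < real CARD('a) powi n"
  shows "vec_norm v \<le> real CARD('a) powi (n - 1)"
proof (cases "v = 0")
  case False
  then obtain m where "vec_norm v = real CARD('a) powi m" by (rule vec_norm_powi)
  then show ?thesis using assms by simp
qed simp

lemma vec_norm_mult_le:
  fixes M :: "'a::{field,finite} fls ^ 'd ^ 'e"
  assumes "\<And>i j. fls_abs (M $ i $ j) \<le> r"
  shows "vec_norm (M *v v) \<le> r * vec_norm v"
proof -
  have r: "r \<ge> 0" using assms fls_abs_nonneg order_trans by blast
  have "fls_abs ((M *v v) $ i) \<le> r * vec_norm v" for i
    unfolding matrix_vector_mult_def vec_lambda_beta
    using r by (intro fls_abs_sum_le)
      (auto simp: fls_abs_mult vec_norm_nonneg intro!: mult_mono assms fls_abs_le_vec_norm fls_abs_nonneg)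
  then show ?thesis by (simp add: vec_norm_le_iff)
qed

text \<open>A matrix with entries of absolute value at most \<open>q\<^sup>n\<close> scales every norm by exactly \<open>q\<^sup>n\<close>
  as soon as it shrinks no nonzero constant vector, which has norm \<open>1\<close>, by more than this. If
  \<open>\<parallel>v\<parallel> = q\<^sup>N\<close>, then the coefficients of \<open>x\<^sup>n\<^sup>+\<^sup>N\<close> in \<open>M v\<close> are the coefficients of \<open>x\<^sup>n\<close> in \<open>M c\<close>,
  where \<open>c\<close> is the constant vector of the coefficients of \<open>x\<^sup>N\<close> in \<open>v\<close>. No higher
  power of \<open>x\<close> occurs in either vector, and \<open>M c\<close> has norm at least \<open>q\<^sup>n\<close>, so these coefficients
  cannot all vanish.\<close>

lemma similarity_of_constant_combinations:
  fixes M :: "'a::{field,finite} fls ^ 'd ^ 'd"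
  assumes M_le: "\<And>i j. fls_abs (M $ i $ j) \<le> real CARD('a) powi n"
    and const: "\<And>c :: 'd \<Rightarrow> 'a. (\<exists>j. c j \<noteq> 0) \<Longrightarrow>
       vec_norm (M *v (\<chi> j. fls_const (c j))) \<ge> real CARD('a) powi n"
  shows "vec_norm (M *v v) = real CARD('a) powi n * vec_norm v"
proof (cases "v = 0")
  case False
  then obtain N where N: "vec_norm v = real CARD('a) powi N" by (rule vec_norm_powi)
  define c where "c j = fls_nth (v $ j) (- N)" for j
  define w :: "'a fls ^ 'd" where "w = (\<chi> j. fls_const (c j))"
  have M0: "\<forall>k < - n. fls_nth (M $ i $ j) k = 0" for i j
    using M_le[of i j] by (simp add: fls_abs_le_powi_iff)
  have v0: "\<forall>k < - N. fls_nth (v $ j) k = 0" for j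
    using fls_abs_le_vec_norm[of v j] N by (simp add: fls_abs_le_powi_iff)
  have "\<exists>j. c j \<noteq> 0"
  proof (rule ccontr)
    assume "\<nexists>j. c j \<noteq> 0"
    then have "fls_nth (v $ j) k = 0" if "k < - (N - 1)" for j k
      using v0[of j] that by (cases "k = - N") (auto simp: c_def)
    then have "vec_norm v \<le> real CARD('a) powi (N - 1)"
      by (auto simp: vec_norm_le_iff fls_abs_le_powi_iff)
    then show False using N card_field_gt_1[where 'a = 'a] by simp
  qed
  then have w_ge: "vec_norm (M *v w) \<ge> real CARD('a) powi n"
    unfolding w_def by (rule const)
  have lead: "fls_nth ((M *v v) $ i) (- n + - N) = fls_nth ((M *v w) $ i) (- n)" for i
  proof -
    have "fls_nth (M $ i $ j * v $ j) (- n + - N) = fls_nth (M $ i $ j * fls_const (c j)) (- n)" for j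
      using fls_times_nth_lowest[OF M0[of i j] v0[of j]] by (simp add: c_def)
    then show ?thesis
      by (simp add: matrix_vector_mult_def w_def fls_nth_sum)
  qed
  have wn: "vec_norm w \<le> 1"
    by (auto simp: vec_norm_le_iff w_def fls_abs_def)
  have upper: "vec_norm (M *v v) \<le> real CARD('a) powi n * vec_norm v"
    by (rule vec_norm_mult_le) (rule M_le)
  show ?thesis
  proof (rule ccontr)
    assume "\<not> ?thesis"
    then have "vec_norm (M *v v) < real CARD('a) powi (n + N)"
      using upper N card_field_gt_1[where 'a = 'a] by (simp add: power_int_add)
    then have "vec_norm (M *v v) \<le> real CARD('a) powi (n + N - 1)"
      by (rule vec_norm_less_imp_le_powi)
    then have top: "fls_nth ((M *v w) $ i) (- n) = 0" for i
      using lead[of i] by (simp add: vec_norm_le_iff fls_abs_le_powi_iff)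
    have "vec_norm (M *v w) \<le> real CARD('a) powi n * vec_norm w"
      by (rule vec_norm_mult_le) (rule M_le)
    also have "\<dots> \<le> real CARD('a) powi n" using wn by (simp add: mult_left_le)
    finally have "fls_nth ((M *v w) $ i) k = 0" if "k < - n" for i k
      using that by (simp add: vec_norm_le_iff fls_abs_le_powi_iff)
    then have "fls_nth ((M *v w) $ i) k = 0" if "k < - (n - 1)" for i k
      using top[of i] that by (cases "k = - n") auto
    then have "vec_norm (M *v w) \<le> real CARD('a) powi (n - 1)"
      by (simp add: vec_norm_le_iff fls_abs_le_powi_iff)
    also have "\<dots> < real CARD('a) powi n"
      using card_field_gt_1[where 'a = 'a] by simp
    finally show False using w_ge by simp
  qed
qed simp

section \<open>Polynomials and polynomial parts\<close>

lemma mem_poly_ring_iff: "f \<in> poly_ring \<longleftrightarrow> (\<forall>k>0. fls_nth f k = 0)"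
proof
  assume R: "\<forall>k>0. fls_nth f k = 0"
  (* fls_prpart keeps only the negative powers of x^-1, so the constant term is added back. *)
  have "f = fls_of_poly (fls_prpart f + [:fls_nth f 0:])"
  proof (rule fls_eqI)
    fix k
    show "fls_nth f k = fls_nth (fls_of_poly (fls_prpart f + [:fls_nth f 0:])) k"
      using R by (cases "k = 0"; cases "k < 0")
        (auto simp: fls_nth_fls_of_poly coeff_pCons split: nat.split)
  qed
  then show "f \<in> poly_ring" by (simp add: poly_ring_def)
qed (auto simp: poly_ring_def fls_nth_fls_of_poly)

lemma fls_of_poly_smult: "fls_of_poly (smult c p) = fls_const c * fls_of_poly p"
  by (rule fls_eqI) (simp add: fls_nth_fls_of_poly)

lemma fls_of_poly_add: "fls_of_poly (p + q) = fls_of_poly p + fls_of_poly q"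
  by (rule fls_eqI) (simp add: fls_nth_fls_of_poly)

lemma fls_of_poly_pCons: "fls_of_poly (pCons a p) = fls_const a + fls_X_inv * fls_of_poly p"
  by (cases "a = 0 \<and> p = 0") (auto simp: fls_of_poly_def map_poly_pCons)

lemma fls_of_poly_mult: "fls_of_poly (p * q) = fls_of_poly p * fls_of_poly q"
proof (induction p)
  case 0
  then show ?case by (simp add: fls_of_poly_def)
next
  case (pCons a p)
  then show ?case
    by (simp add: fls_of_poly_add fls_of_poly_smult fls_of_poly_pCons algebra_simps)
qed

lemma poly_ring_add: "f \<in> poly_ring \<Longrightarrow> g \<in> poly_ring \<Longrightarrow> f + g \<in> poly_ring"
  by (auto simp: mem_poly_ring_iff)

lemma poly_ring_diff: "f \<in> poly_ring \<Longrightarrow> g \<in> poly_ring \<Longrightarrow> f - g \<in> poly_ring"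
  by (auto simp: mem_poly_ring_iff)

lemma poly_ring_mult: "f \<in> poly_ring \<Longrightarrow> g \<in> poly_ring \<Longrightarrow> f * g \<in> poly_ring"
  by (auto simp: poly_ring_def simp flip: fls_of_poly_mult)

lemma poly_ring_const: "fls_const c \<in> poly_ring"
  by (simp add: mem_poly_ring_iff)

lemma poly_ring_1: "1 \<in> poly_ring"
  by (simp add: mem_poly_ring_iff)

lemma poly_ring_sum: "(\<And>i. i \<in> A \<Longrightarrow> f i \<in> poly_ring) \<Longrightarrow> sum f A \<in> poly_ring"
  by (simp add: mem_poly_ring_iff fls_nth_sum)

lemma fls_abs_poly_ring_ge_1:
  assumes "f \<in> poly_ring" "f \<noteq> 0"
  shows "fls_abs f \<ge> 1"
proof -
  obtain p where p: "f = fls_of_poly p" using assms by (auto simp: poly_ring_def)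
  then have "p \<noteq> 0" using assms by (auto simp: fls_of_poly_def)
  then show ?thesis
    using p card_field_gt_1[where 'a = 'a] by (simp add: fls_abs_fls_of_poly one_le_power)
qed

lemma poly_part:
  fixes f :: "'a::{field,finite} fls"
  obtains p where "p \<in> poly_ring" "fls_abs (f - p) \<le> inverse (real CARD('a))"
proof -
  define p where "p = fls_of_poly (fls_prpart f + [:fls_nth f 0:])"
  have "fls_nth (f - p) k = 0" if "k < 1" for k
    using that by (cases "k = 0")
      (auto simp: p_def fls_nth_fls_of_poly coeff_pCons split: nat.split)
  then have "fls_abs (f - p) \<le> real CARD('a) powi (- 1)"
    unfolding fls_abs_le_powi_iff by simp
  moreover have "p \<in> poly_ring" by (simp add: p_def poly_ring_def)
  ultimately show ?thesis using that by simp
qed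

lemma poly_vectors_mult:
  fixes P :: "'a::field fls ^ 'd ^ 'e"
  assumes "\<And>i j. P $ i $ j \<in> poly_ring" "w \<in> poly_vectors"
  shows "P *v w \<in> poly_vectors"
  using assms by (auto simp: poly_vectors_def matrix_vector_mult_def intro!: poly_ring_sum poly_ring_mult)

lemma vec_poly_part:
  fixes v :: "'a::{field,finite} fls ^ 'd"
  obtains p where "p \<in> poly_vectors" "vec_norm (v - p) \<le> inverse (real CARD('a))"
proof -
  have "\<forall>i. \<exists>p. p \<in> poly_ring \<and> fls_abs (v $ i - p) \<le> inverse (real CARD('a))"
    using poly_part by blast
  then obtain p where "\<And>i. p i \<in> poly_ring \<and> fls_abs (v $ i - p i) \<le> inverse (real CARD('a))"
    by metis
  then show ?thesis
    by (intro that[of "\<chi> i. p i"]) (auto simp: poly_vectors_def vec_norm_le_iff)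
qed

lemma vec_norm_poly_vectors_ge_1:
  assumes "w \<in> poly_vectors" "w \<noteq> 0"
  shows "vec_norm w \<ge> 1"
proof -
  obtain i where "w $ i \<noteq> 0" using assms(2) by (auto simp: vec_eq_iff)
  then have "fls_abs (w $ i) \<ge> 1"
    using assms(1) by (intro fls_abs_poly_ring_ge_1) (auto simp: poly_vectors_def)
  then show ?thesis using fls_abs_le_vec_norm order_trans by blast
qed

section \<open>Determinants\<close>

lemma det_in_subring:
  fixes M :: "'b::comm_ring_1 ^ 'd ^ 'd"
  assumes "1 \<in> S" "- 1 \<in> S"
    and add: "\<And>x y. x \<in> S \<Longrightarrow> y \<in> S \<Longrightarrow> x + y \<in> S"
    and mult: "\<And>x y. x \<in> S \<Longrightarrow> y \<in> S \<Longrightarrow> x * y \<in> S"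
    and M: "\<And>i j. M $ i $ j \<in> S"
  shows "det M \<in> S"
proof -
  have 0: "0 \<in> S" using add[OF assms(1,2)] by simp
  have prod: "prod f A \<in> S" if "\<And>i. i \<in> A \<Longrightarrow> f i \<in> S" for f :: "'d \<Rightarrow> 'b" and A
    using that by (induction A rule: infinite_finite_induct) (auto intro: assms)
  have sum: "sum f A \<in> S" if "\<And>p. p \<in> A \<Longrightarrow> f p \<in> S" for f :: "('d \<Rightarrow> 'd) \<Rightarrow> 'b" and A
    using that by (induction A rule: infinite_finite_induct) (auto intro: 0 add)
  have "of_int (sign p) \<in> S" for p :: "'d \<Rightarrow> 'd"
    using assms(1,2) by (simp add: sign_def)
  then show ?thesis
    unfolding det_def by (intro sum mult prod M)
qed

lemma fls_abs_det_le_1: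
  fixes M :: "'a::{field,finite} fls ^ 'd ^ 'd"
  assumes "\<And>i j. fls_abs (M $ i $ j) \<le> 1"
  shows "fls_abs (det M) \<le> 1"
proof -
  have "det M \<in> {f. fls_abs f \<le> 1}"
    using assms by (intro det_in_subring)
      (auto intro: fls_abs_add_le simp: fls_abs_mult mult_le_one fls_abs_nonneg)
  then show ?thesis by simp
qed

lemma fls_abs_det_poly_ge_1:
  fixes P :: "'a::{field,finite} fls ^ 'd ^ 'd"
  assumes "\<And>i j. P $ i $ j \<in> poly_ring" "det P \<noteq> 0"
  shows "fls_abs (det P) \<ge> 1"
proof -
  have "- 1 \<in> (poly_ring :: 'a fls set)" by (simp add: mem_poly_ring_iff)
  then have "det P \<in> poly_ring"
    using assms(1) by (intro det_in_subring) (auto intro: poly_ring_1 poly_ring_add poly_ring_mult)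
  then show ?thesis using assms(2) by (rule fls_abs_poly_ring_ge_1)
qed

lemma mult_axis_eq_column: "(M :: 'b::semiring_1 ^ 'd ^ 'e) *v axis j 1 = column j M"
  by (simp add: vec_eq_iff matrix_vector_mult_def axis_def column_def
      if_distrib[of "\<lambda>a. _ * a"] cong: if_cong)

lemma vec_norm_axis: "vec_norm (axis j f) = fls_abs f"
proof (rule antisym)
  show "vec_norm (axis j f) \<le> fls_abs f"
    by (auto simp: vec_norm_le_iff axis_def fls_abs_nonneg fls_abs_def[of 0])
  show "fls_abs f \<le> vec_norm (axis j f)"
    using fls_abs_le_vec_norm[of "axis j f" j] by simp
qed

text \<open>Dividing by the ratio turns \<open>M\<close> into an isometry \<open>U\<close>. An isometry has entries of absolute
  value at most \<open>1\<close>, hence also its determinant; the same holds for its inverse, so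
  \<open>\<bar>det U\<bar> = 1\<close>. Thus \<open>\<bar>det M\<bar>\<close> is the \<open>d\<close>-th power of the ratio.\<close>

lemma similarity_ratio_1:
  fixes M :: "'a::{field,finite} fls ^ 'd ^ 'd"
  assumes sim: "\<And>v. vec_norm (M *v v) = real CARD('a) powi n * vec_norm v"
    and det: "fls_abs (det M) = 1"
  shows "n = 0"
proof -
  let ?q = "real CARD('a)"
  note q = card_field_gt_1[where 'a = 'a]
  \<comment> \<open>The formal variable is \<open>x\<^sup>-\<^sup>1\<close>, so its \<open>n\<close>-th power has absolute value \<open>q\<^sup>-\<^sup>n\<close>.\<close>
  define c :: "'a fls" where "c = fls_X_intpow n"
  define U where "U = mat c ** M"
  have c: "fls_abs c = ?q powi (- n)" by (simp add: c_def fls_abs_def)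
  have "det M \<noteq> 0" using det by (auto simp: fls_abs_def)
  moreover have det_mat: "det (mat c :: 'a fls ^ 'd ^ 'd) = c ^ CARD('d)"
    by (subst det_diagonal) (auto simp: mat_def)
  moreover have "c \<noteq> 0" by (simp add: c_def)
  ultimately have "det U \<noteq> 0" by (simp add: U_def det_mul)
  then have "invertible U" by (simp add: invertible_det_nz)
  then obtain V where V: "U ** V = mat 1" "V ** U = mat 1" by (auto simp: invertible_def)
  have "mat c *v v = c *s v" for v :: "'a fls ^ 'd"
    by (simp add: vec_eq_iff matrix_vector_mult_def mat_def if_distrib[of "\<lambda>a. a * _"] cong: if_cong)
  then have isoU: "vec_norm (U *v v) = vec_norm v" for v
    using q by (simp add: U_def sim vec_norm_smult c power_int_minus flip: matrix_vector_mul_assoc)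
  have isoV: "vec_norm (V *v v) = vec_norm v" for v
    using isoU[of "V *v v"] V by (simp add: matrix_vector_mul_assoc)
  have iso_det: "fls_abs (det W) \<le> 1" if "\<And>v. vec_norm (W *v v) = vec_norm v"
    for W :: "'a fls ^ 'd ^ 'd"
  proof (rule fls_abs_det_le_1)
    fix i j
    show "fls_abs (W $ i $ j) \<le> 1"
      using fls_abs_le_vec_norm[of "W *v axis j 1" i] that[of "axis j 1"]
      by (simp add: mult_axis_eq_column column_def vec_norm_axis)
  qed
  have "fls_abs (det U) * fls_abs (det V) = 1"
    using V(1) by (metis det_I det_mul fls_abs_mult fls_abs_one)
  then have "fls_abs (det U) = 1"
    using iso_det[OF isoU] iso_det[OF isoV] fls_abs_nonneg[of "det U"]
    by (metis antisym mult_left_le mult.right_neutral)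
  moreover have "fls_abs (c ^ k) = (fls_abs c) ^ k" for k
    by (induction k) (auto simp: fls_abs_mult)
  ultimately have "(?q powi (- n)) ^ CARD('d) = 1"
    using det by (simp add: U_def det_mul fls_abs_mult det_mat c)
  then have "?q powi (- n) = 1"
    using q power_eq_iff_eq_base[of "CARD('d)" "?q powi (- n)" 1] by simp
  then have "?q powi (- n) = ?q powi 0" by simp
  then show ?thesis by (simp only: card_powi_eq_iff)
qed

section \<open>Lattices\<close>

text \<open>The content is that the minimum defining the shortest length is attained. If \<open>g\<close> has an
  inverse \<open>h\<close> with entries bounded by \<open>C\<close>, then \<open>g w\<close> has norm at least \<open>\<parallel>w\<parallel> / C \<ge> 1 / C\<close> for
  every nonzero polynomial vector \<open>w\<close>. So the norms of nonzero lattice vectors are integral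
  powers of \<open>q\<close> with exponents bounded from below.\<close>

lemma shortest_length_le:
  fixes g :: "'a::{field,finite} fls ^ 'd ^ 'd"
  assumes g: "invertible g" and L: "L = (\<lambda>v. g *v v) ` poly_vectors"
    and v: "v \<in> L" "v \<noteq> 0"
  shows "shortest_length L \<le> vec_norm v"
proof -
  let ?q = "real CARD('a)"
  note q = card_field_gt_1[where 'a = 'a]
  obtain h where h: "h ** g = mat 1" using g by (auto simp: invertible_def)
  define C where "C = Max (range (\<lambda>(i, j). fls_abs (h $ i $ j)))"
  have C: "fls_abs (h $ i $ j) \<le> C" for i j
    unfolding C_def by (rule Max_ge) auto
  have bound: "1 \<le> C * vec_norm v" if "v \<in> L" "v \<noteq> 0" for v
  proof -
    obtain w where w: "w \<in> poly_vectors" "v = g *v w" using \<open>v \<in> L\<close> L by auto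
    have "w = h *v v" using w h by (simp add: matrix_vector_mul_assoc)
    moreover have "w \<noteq> 0" using w \<open>v \<noteq> 0\<close> by auto
    ultimately show ?thesis
      using vec_norm_poly_vectors_ge_1[OF w(1)] vec_norm_mult_le[OF C, of v] by simp
  qed
  have "C > 0"
    using bound[OF v] vec_norm_nonneg[of v] by (smt (verit) mult_nonpos_nonneg)
  obtain k where k: "C < ?q ^ k"
    using real_arch_pow[OF q] by blast
  have "\<forall>v :: 'a fls ^ 'd. \<exists>n. v \<noteq> 0 \<longrightarrow> vec_norm v = ?q powi n"
    using vec_norm_powi by blast
  then obtain e where e: "\<And>v :: 'a fls ^ 'd. v \<noteq> 0 \<Longrightarrow> vec_norm v = ?q powi (e v)"
    by metis
  have e_ge: "e v \<ge> - int k" if "v \<in> L" "v \<noteq> 0" for v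
  proof -
    have "1 \<le> C * vec_norm v" using bound that .
    also have "\<dots> \<le> ?q ^ k * vec_norm v" using k vec_norm_nonneg by (intro mult_right_mono) auto
    also have "\<dots> = ?q powi (int k + e v)" using q e[OF that(2)] by (simp add: power_int_add)
    finally have "?q powi 0 \<le> ?q powi (int k + e v)" by simp
    then have "0 \<le> int k + e v" by (simp only: card_powi_le_iff)
    then show ?thesis by simp
  qed
  obtain m where m: "m \<in> L" "m \<noteq> 0"
    and min: "\<And>u. u \<in> L \<and> u \<noteq> 0 \<Longrightarrow> nat (e m + int k) \<le> nat (e u + int k)"
    using ex_has_least_nat[of "\<lambda>u. u \<in> L \<and> u \<noteq> 0" v "\<lambda>u. nat (e u + int k)"] v by blast
  have le: "vec_norm m \<le> vec_norm u" if "u \<in> L" "u \<noteq> 0" for u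
    using min[of u] e_ge[OF that] e_ge[OF m] that q by (simp add: e m)
  have "shortest_length L = vec_norm m"
    unfolding shortest_length_def by (rule Least_equality) (use m le in auto)
  then show ?thesis using le[OF v] by simp
qed

text \<open>Comparing determinants through this transition matrix is how inclusions between
  lattices become inequalities between covolumes.\<close>

lemma transition_matrix:
  fixes g M :: "'a::field fls ^ 'd ^ 'd"
  assumes "\<And>j. column j M \<in> (\<lambda>v. g *v v) ` poly_vectors"
  obtains P :: "'a fls ^ 'd ^ 'd" where "\<And>i j. P $ i $ j \<in> poly_ring" "M = g ** P"
proof -
  have "\<forall>j. \<exists>p \<in> poly_vectors. column j M = g *v p" using assms by blast
  then obtain p where p: "\<And>j. p j \<in> poly_vectors" "\<And>j. column j M = g *v p j" by metis
  define P where "P = (\<chi> i j. p j $ i)"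
  have "M $ i $ j = (g ** P) $ i $ j" for i j
    using arg_cong[OF p(2)[of j], of "\<lambda>v. v $ i"]
    by (simp add: P_def column_def matrix_matrix_mult_def matrix_vector_mult_def)
  then have "M = g ** P" by (simp add: vec_eq_iff)
  moreover have "P $ i $ j \<in> poly_ring" for i j using p(1) by (simp add: P_def poly_vectors_def)
  ultimately show ?thesis using that by blast
qed

lemma sublattice_covolume_ge:
  fixes g M :: "'a::{field,finite} fls ^ 'd ^ 'd"
  assumes sub: "(\<lambda>v. M *v v) ` poly_vectors \<subseteq> (\<lambda>v. g *v v) ` poly_vectors"
    and "invertible M"
  shows "fls_abs (det g) \<le> fls_abs (det M)"
proof -
  have "axis j 1 \<in> poly_vectors" for j
    by (auto simp: poly_vectors_def axis_def mem_poly_ring_iff)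
  then have "column j M \<in> (\<lambda>v. g *v v) ` poly_vectors" for j
    using sub by (metis image_eqI mult_axis_eq_column subsetD)
  then obtain P where P: "\<And>i j. P $ i $ j \<in> poly_ring" "M = g ** P"
    using transition_matrix by blast
  have "det P \<noteq> 0"
    using \<open>invertible M\<close> P(2) by (auto simp: invertible_det_nz det_mul)
  then have "fls_abs (det P) \<ge> 1" using fls_abs_det_poly_ge_1 P(1) by blast
  then show ?thesis
    using P(2) fls_abs_nonneg[of "det g"] by (simp add: det_mul fls_abs_mult mult_le_cancel_left1)
qed

section \<open>Well rounded lattices\<close>

text \<open>The shortest vectors \<open>b\<^sub>j\<close> that witness well roundedness form a basis of the lattice, and
  an orthogonal one. Orthogonality: a combination of the \<open>b\<^sub>j\<close> with constant coefficients, not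
  all zero, is a nonzero lattice vector, hence no shorter than the \<open>b\<^sub>j\<close>, so their leading
  coefficients are linearly independent. They generate the lattice because the fractional
  parts of the coordinates of a lattice vector \<open>v\<close> in terms of the \<open>b\<^sub>j\<close> give a lattice vector
  which, by orthogonality, is strictly shorter than the \<open>b\<^sub>j\<close>, hence zero.\<close>

lemma well_rounded_orthogonal_basis:
  fixes g :: "'a::{field,finite} fls ^ 'd ^ 'd"
  assumes g: "invertible g" and L: "L = (\<lambda>v. g *v v) ` poly_vectors"
    and "well_rounded L"
  obtains M :: "'a fls ^ 'd ^ 'd" and n
    where "invertible M" "L = (\<lambda>v. M *v v) ` poly_vectors"
      "\<And>v. vec_norm (M *v v) = real CARD('a) powi n * vec_norm v"
proof -
  let ?q = "real CARD('a)"
  note q = card_field_gt_1[where 'a = 'a]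
  obtain B where B: "B \<subseteq> L" "card B = CARD('d)" "vec.independent B"
    and short: "\<And>v. v \<in> B \<Longrightarrow> vec_norm v = shortest_length L"
    using assms by (auto simp: well_rounded_def)
  have "finite B" using B(2) by (metis card.infinite zero_less_card_finite less_irrefl)
  then obtain b :: "'d \<Rightarrow> 'a fls ^ 'd" where b: "bij_betw b UNIV B"
    using B(2) finite_same_card_bij[of "UNIV :: 'd set" B] by auto
  define M where "M = (\<chi> i j. b j $ i)"
  have col: "column j M = b j" for j by (simp add: M_def column_def vec_eq_iff)
  have bB: "b j \<in> B" for j using b by (auto simp: bij_betw_def)
  have "\<exists>N. N ** M = mat 1"
    unfolding matrix_left_invertible_independent_columns col
  proof (intro allI impI)
    fix c :: "'d \<Rightarrow> 'a fls" and i
    assume "(\<Sum>i\<in>UNIV. c i *s b i) = 0"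
    moreover have "(\<Sum>i\<in>UNIV. c i *s b i) = (\<Sum>v\<in>B. c (inv b v) *s v)"
      using b by (subst sum.reindex_bij_betw[OF b, symmetric]) (simp add: bij_betw_def)
    ultimately have "c (inv b (b i)) = 0"
      using vec.independentD[OF B(3) \<open>finite B\<close> order_refl _ bB, of "\<lambda>v. c (inv b v)"] by simp
    then show "c i = 0" using b by (simp add: bij_betw_def)
  qed
  then have inv: "invertible M"
    by (metis invertible_def matrix_left_right_inverse)
  have "column j M \<in> (\<lambda>v. g *v v) ` poly_vectors" for j using bB B(1) unfolding col L by blast
  then obtain P where P: "\<And>i j. P $ i $ j \<in> poly_ring" "M = g ** P"
    using transition_matrix by blast
  have M_in: "M *v w \<in> L" if "w \<in> poly_vectors" for w
    using poly_vectors_mult[OF P(1) that] by (auto simp: P(2) L simp flip: matrix_vector_mul_assoc)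
  have M_nz: "M *v w \<noteq> 0" if "w \<noteq> 0" for w
    using inv that
    by (metis invertible_def matrix_vector_mul_assoc matrix_vector_mul_lid matrix_vector_mult_0_right)
  have lb: "shortest_length L \<le> vec_norm v" if "v \<in> L" "v \<noteq> 0" for v
    using shortest_length_le[OF g L that] .
  have b_nz: "b j \<noteq> 0" for j using bB B(3) vec.dependent_zero by metis
  obtain n where n: "shortest_length L = ?q powi n"
    using vec_norm_powi[OF b_nz] short[OF bB] by metis
  have sim: "vec_norm (M *v v) = ?q powi n * vec_norm v" for v
  proof (rule similarity_of_constant_combinations)
    show "fls_abs (M $ i $ j) \<le> ?q powi n" for i j
      using fls_abs_le_vec_norm[of "b j" i] short[OF bB] n by (simp add: M_def)
    fix c :: "'d \<Rightarrow> 'a"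
    assume "\<exists>j. c j \<noteq> 0"
    then have "(\<chi> j. fls_const (c j)) \<noteq> 0" by (auto simp: vec_eq_iff)
    then show "?q powi n \<le> vec_norm (M *v (\<chi> j. fls_const (c j)))"
      unfolding n[symmetric] by (intro lb M_in M_nz) (auto simp: poly_vectors_def poly_ring_const)
  qed
  have surj: "\<exists>w \<in> poly_vectors. v = M *v w" if v: "v \<in> L" for v
  proof -
    obtain a where a: "v = M *v a"
      using inv by (metis invertible_def matrix_vector_mul_assoc matrix_vector_mul_lid)
    obtain w where w: "w \<in> poly_vectors" "vec_norm (a - w) \<le> inverse ?q" by (rule vec_poly_part)
    obtain u where u: "u \<in> poly_vectors" "v = g *v u" using v L by auto
    have "M *v w \<in> L" using w M_in by simp
    then obtain u' where u': "u' \<in> poly_vectors" "M *v w = g *v u'" using L by auto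
    have "M *v (a - w) = g *v (u - u')"
      using a u u' by (simp add: matrix_vector_mult_diff_distrib)
    moreover have "u - u' \<in> poly_vectors" using u u' by (simp add: poly_vectors_def poly_ring_diff)
    ultimately have in_L: "M *v (a - w) \<in> L" by (simp add: L)
    have "vec_norm (a - w) < 1"
      using w(2) q by (simp add: inverse_less_1_iff order_le_less_trans)
    then have "vec_norm (M *v (a - w)) < ?q powi n" using q by (simp add: sim)
    then have "M *v (a - w) = 0" using lb[OF in_L] n by fastforce
    then have "v = M *v w" using a by (simp add: matrix_vector_mult_diff_distrib)
    then show ?thesis using w by blast
  qed
  have "L = (\<lambda>v. M *v v) ` poly_vectors" using surj M_in by auto
  then show ?thesis using that inv sim by blast
qed

text \<open>Unimodularity fixes the ratio of the similarity: all bases of a lattice have the same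
  covolume, here \<open>1\<close>, and a similarity with this covolume is an isometry. In particular the
  shortest vectors of a well rounded unimodular lattice have norm \<open>1\<close>.\<close>

lemma well_rounded_isometric_basis:
  fixes L :: "('a::{field,finite} fls ^ 'd) set"
  assumes "L \<in> well_rounded_lattices"
  obtains M :: "'a fls ^ 'd ^ 'd"
    where "invertible M" "L = (\<lambda>v. M *v v) ` poly_vectors" "\<And>v. vec_norm (M *v v) = vec_norm v"
proof -
  obtain g :: "'a fls ^ 'd ^ 'd" where g: "invertible g" "fls_abs (det g) = 1"
    and L: "L = (\<lambda>v. g *v v) ` poly_vectors" and "well_rounded L"
    using assms by (auto simp: well_rounded_lattices_def unimodular_lattices_def)
  then obtain M :: "'a fls ^ 'd ^ 'd" and n where inv: "invertible M"
    and L_M: "L = (\<lambda>v. M *v v) ` poly_vectors"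
    and sim: "\<And>v. vec_norm (M *v v) = real CARD('a) powi n * vec_norm v"
    using well_rounded_orthogonal_basis[OF g(1) L] by blast
  have "fls_abs (det M) = 1"
    using sublattice_covolume_ge[of M g] sublattice_covolume_ge[of g M] g inv L L_M
    by (simp add: antisym)
  then have "n = 0" using similarity_ratio_1[OF sim] by blast
  then show ?thesis using that[OF inv L_M] sim by simp
qed

section \<open>The covering radius\<close>

theorem corollary1p33:
  fixes \<Lambda> :: "('a::{field,finite} fls ^ 'd) set"
  assumes "CARD('d) \<ge> 2"
    and "\<Lambda> \<in> well_rounded_lattices"
  shows "cov_rad \<Lambda> = inverse (real CARD('a))"
proof -
  let ?q = "real CARD('a)"
  note q = card_field_gt_1[where 'a = 'a]
  obtain M :: "'a fls ^ 'd ^ 'd" where inv: "invertible M"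
    and L: "\<Lambda> = (\<lambda>v. M *v v) ` poly_vectors" and iso: "\<And>v. vec_norm (M *v v) = vec_norm v"
    using well_rounded_isometric_basis[OF assms(2)] by blast
  show ?thesis
    unfolding cov_rad_def
  proof (rule Least_equality)
    have "\<exists>u w. v = u + w \<and> u \<in> \<Lambda> \<and> w \<in> norm_cball (inverse ?q)" for v
    proof -
      obtain a where a: "v = M *v a"
        using inv by (metis invertible_def matrix_vector_mul_assoc matrix_vector_mul_lid)
      obtain p where p: "p \<in> poly_vectors" "vec_norm (a - p) \<le> inverse ?q" by (rule vec_poly_part)
      have "v = M *v p + M *v (a - p)" by (simp add: a matrix_vector_mult_diff_distrib)
      then show ?thesis
        using p L by (intro exI[of _ "M *v p"] exI[of _ "M *v (a - p)"]) (auto simp: norm_cball_def iso)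
    qed
    then show "inverse ?q > 0 \<and> {u + w | u w. u \<in> \<Lambda> \<and> w \<in> norm_cball (inverse ?q)} = UNIV"
      using q by auto
  next
    fix r
    assume r: "r > 0 \<and> {u + w | u w. u \<in> \<Lambda> \<and> w \<in> norm_cball r} = UNIV"
    fix j :: 'd
    (* The point M x^-1 e_j is not covered by any smaller radius: subtracting a polynomial
       cannot change the coefficient of x^-1. *)
    have "M *v axis j fls_X \<in> {u + w | u w. u \<in> \<Lambda> \<and> w \<in> norm_cball r}" using r by simp
    then obtain p w where p: "p \<in> poly_vectors" and w: "vec_norm w \<le> r"
      and eq: "M *v axis j fls_X = M *v p + w"
      by (auto simp: L norm_cball_def)
    have "w = M *v (axis j fls_X - p)" using eq by (simp add: matrix_vector_mult_diff_distrib)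
    then have "vec_norm w = vec_norm (axis j fls_X - p)" by (simp add: iso)
    moreover have "fls_abs (fls_X - p $ j) \<le> vec_norm (axis j fls_X - p)"
      using fls_abs_le_vec_norm[of "axis j fls_X - p" j] by simp
    moreover have "\<not> fls_abs (fls_X - p $ j) \<le> ?q powi (- 2)"
    proof -
      have "fls_nth (p $ j) 1 = 0" using p by (auto simp: poly_vectors_def mem_poly_ring_iff)
      then show ?thesis by (auto simp: fls_abs_le_powi_iff intro!: exI[of _ 1])
    qed
    ultimately have "\<not> vec_norm w \<le> ?q powi (- 1 - 1)" by simp
    then have "\<not> vec_norm w < ?q powi (- 1)" using vec_norm_less_imp_le_powi by blast
    then show "inverse ?q \<le> r" using w by simp
  qed
qed

end
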